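(* Let $\mu>\frac12$ and let $(q_n)_{n\ge 1}$ be a sequence with $0<q_n<1$ such that $\lim_{n\to\infty} q_n=1$ and $\lim_{n\to\infty} q_n^{\,n}=a$ for some constant $a$. Then for every function $f\in C[0,\infty)\cap H$, $$\lim_{n\to\infty} D_{n,q_n}^*(f;x)=f(x)$$ uniformly in $x$ on each compact subset of $[0,\infty)$.
   Context: For $0<q<1$ and $n\in\mathbb{N}=\{1,2,\dots\}$ let $[n]_q=\frac{1-q^n}{1-q}$. For an integer $k\ge 0$ let $\theta_k=0$ if $k$ is even and $\theta_k=1$ if $k$ is odd. For $\mu>\frac12$ define $\gamma_{\mu,q}(0)=1$ and $\gamma_{\mu,q}(k+1)=\frac{1-q^{2\mu\theta_{k+1}+k+1}}{1-q}\,\gamma_{\mu,q}(k)$ for $k=0,1,2,\dots$, and $$E_{\mu,q}(x)=\sum_{k=0}^\infty \frac{q^{k(k-1)/2}x^k}{\gamma_{\mu,q}(k)},\qquad x\in[0,\infty).$$ The Dunkl $q$-parametric Sz\'asz-Mirakjan operators are, for $f\in C[0,\infty)$, $x\in[0,\infty)$, $n\in\mathbb{N}$, $$D_{n,q}^*(f;x)=\frac{1}{E_{\mu,q}([n]_qx)}\sum_{k=0}^\infty \frac{([n]_qx)^k}{\gamma_{\mu,q}(k)}\,q^{k(k-1)/2}\, f\!\left(\frac{1-q^{2\mu\theta_k+k}}{q^{k-2}(1-q^n)}\right).$$ $C[0,\infty)$ is the space of continuous real functions on $[0,\infty)$, and $H$ is the set of functions $f$ on $[0,\infty)$ such that $\frac{f(x)}{1+x^2}$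 converges (to a finite limit) as $x\to\infty$. *)

theory Defs
  imports "HOL-Analysis.Analysis"
begin

definition q_bracket :: "real \<Rightarrow> nat \<Rightarrow> real" where
  "q_bracket q n = (1 - q ^ n) / (1 - q)"

definition theta :: "nat \<Rightarrow> nat" where
  "theta k = (if even k then 0 else 1)"

(* The exponent 2 * mu * theta k + k is real, hence powr; it is the usual power since q > 0
   in every use below. *)
primrec dunkl_gamma :: "real \<Rightarrow> real \<Rightarrow> nat \<Rightarrow> real" where
  "dunkl_gamma \<mu> q 0 = 1"
| "dunkl_gamma \<mu> q (Suc k) =
     (1 - q powr (2 * \<mu> * real (theta (k + 1)) + real k + 1)) / (1 - q) * dunkl_gamma \<mu> q k"

(* k * (k - 1) is even, and it is 0 for k = 0 despite truncated subtraction,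
   so the division by 2 is exact. *)
definition dunkl_exp :: "real \<Rightarrow> real \<Rightarrow> real \<Rightarrow> real" where
  "dunkl_exp \<mu> q x = (\<Sum>k. q ^ (k * (k - 1) div 2) * x ^ k / dunkl_gamma \<mu> q k)"

(* For 0 < q < 1, mu > 1/2 and n >= 1 all nodes lie in [0, infinity), so only the values of f
   there matter. The exponent k - 2 is an integer, negative for k < 2. *)
definition dunkl_node :: "real \<Rightarrow> real \<Rightarrow> nat \<Rightarrow> nat \<Rightarrow> real" where
  "dunkl_node \<mu> q n k =
     (1 - q powr (2 * \<mu> * real (theta k) + real k)) / (q powi (int k - 2) * (1 - q ^ n))"

definition dunkl_szasz :: "real \<Rightarrow> real \<Rightarrow> nat \<Rightarrow> (real \<Rightarrow> real) \<Rightarrow> real \<Rightarrow> real" where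
  "dunkl_szasz \<mu> q n f x =
     1 / dunkl_exp \<mu> q (q_bracket q n * x) *
     (\<Sum>k. (q_bracket q n * x) ^ k / dunkl_gamma \<mu> q k * q ^ (k * (k - 1) div 2)
            * f (dunkl_node \<mu> q n k))"

(* Functions on [0, infinity) are represented by total functions on the reals
   whose values at negative arguments are irrelevant. *)
definition C_half_line :: "(real \<Rightarrow> real) set" where
  "C_half_line = {f. continuous_on {0..} f}"

definition H_half_line :: "(real \<Rightarrow> real) set" where
  "H_half_line = {f. \<exists>L. ((\<lambda>x. f x / (1 + x\<^sup>2)) \<longlongrightarrow> L) at_top}"

end

theory Submission
  imports Defs
begin

text \<open>
  Write \<open>w\<^sub>k\<close> for the weights, \<open>t\<^sub>k\<close> for the nodes and \<open>m = [n]\<^sub>q\<close>. The identity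
  \<open>t\<^sub>k w\<^sub>k = q x w\<^sub>k\<^sub>-\<^sub>1\<close> shows that the operator maps \<open>t\<close> to \<open>q x\<close>. Applying it once more,
  together with \<open>t\<^sub>k\<^sub>+\<^sub>1 \<le> t\<^sub>k / q + (2\<mu> + 1) q / (q\<^sup>k m)\<close>, reduces the second moment to
  \<open>\<Sum> w\<^sub>k / q\<^sup>k\<close>, which exceeds \<open>\<Sum> w\<^sub>k\<close> by at most the factor \<open>1 + x / q\<close>. So the second
  central moment is at most \<open>(1 - q) x\<^sup>2 + (2\<mu> + 1) x (1 + x) / m\<close>, which tends to 0 uniformly
  on bounded sets. Finally, a continuous \<open>f\<close> of at most quadratic growth satisfies
  \<open>\<bar>f t - f x\<bar> \<le> \<epsilon> + C (t - x)\<^sup>2\<close> uniformly for \<open>x\<close> in a compact set.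
\<close>

text \<open>The q-analogue of \<open>k + 2 * \<mu> * theta k\<close>; \<open>dunkl_gamma\<close> is
  its factorial, and the nodes are multiples of it.\<close>

definition dunkl_bracket :: "real \<Rightarrow> real \<Rightarrow> nat \<Rightarrow> real" where
  "dunkl_bracket \<mu> q k = (1 - q powr (2 * \<mu> * real (theta k) + real k)) / (1 - q)"

text \<open>The argument \<open>y\<close> stays free because the weights are needed both at
  \<open>q_bracket q n * x\<close> and at that value divided by \<open>q\<close>.\<close>

definition dunkl_weight :: "real \<Rightarrow> real \<Rightarrow> real \<Rightarrow> nat \<Rightarrow> real" where
  "dunkl_weight \<mu> q y k = q ^ (k * (k - 1) div 2) * y ^ k / dunkl_gamma \<mu> q k"

text \<open>Mean value theorem on \<open>[q, 1]\<close>: the derivative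
  \<open>s * z powr (s - 1)\<close> is at most \<open>s\<close> there because
  \<open>s \<ge> 1\<close>.\<close>

lemma one_minus_powr_le:
  fixes q s :: real
  assumes "0 < q" "q < 1" "1 \<le> s"
  shows "1 - q powr s \<le> s * (1 - q)"
proof -
  have "\<exists>z. q < z \<and> z < 1 \<and> 1 powr s - q powr s = (1 - q) * (s * z powr (s - 1))"
    using assms by (intro MVT2 has_real_derivative_powr) auto
  then obtain z where z: "q < z" "z < 1" "1 - q powr s = s * (1 - q) * z powr (s - 1)"
    by auto
  have "z powr (s - 1) \<le> 1"
    using z assms by (intro powr_le1) auto
  then have "s * (1 - q) * z powr (s - 1) \<le> s * (1 - q) * 1"
    using assms by (intro mult_left_mono) auto
  then show ?thesis
    using z by simp
qed

context
  fixes \<mu> q :: real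
  assumes mu: "\<mu> > 1 / 2" and q0: "0 < q" and q1: "q < 1"
begin

section \<open>Estimates for the Dunkl brackets\<close>

lemma dunkl_bracket_0: "dunkl_bracket \<mu> q 0 = 0"
  using q0 by (simp add: dunkl_bracket_def theta_def)

lemma dunkl_bracket_ge:
  "1 - q ^ k \<le> (1 - q) * dunkl_bracket \<mu> q k"
proof -
  have "q powr (2 * \<mu> * real (theta k) + real k) \<le> q powr real k"
    using mu q0 q1 by (intro powr_mono') auto
  then show ?thesis
    using q0 q1 by (simp add: dunkl_bracket_def powr_realpow)
qed

text \<open>Keeps \<open>dunkl_gamma\<close> positive and lets the bracket be dropped in the ratio
  test for the weights.\<close>

lemma dunkl_bracket_Suc_ge_1: "1 \<le> dunkl_bracket \<mu> q (Suc k)"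
proof -
  have "q ^ Suc k \<le> q"
    using q0 q1 by (simp add: mult_left_le power_le_one)
  then have "(1 - q) * 1 \<le> 1 - q ^ Suc k"
    by simp
  also note dunkl_bracket_ge
  finally have "(1 - q) * 1 \<le> (1 - q) * dunkl_bracket \<mu> q (Suc k)" .
  then show ?thesis
    using q1 by (simp only: mult_le_cancel_left_pos)
qed

lemma dunkl_bracket_nonneg: "0 \<le> dunkl_bracket \<mu> q k"
  using dunkl_bracket_Suc_ge_1 dunkl_bracket_0 by (cases k) (auto intro: order_trans [of 0 1])

text \<open>From even \<open>k\<close> the exponent rises by \<open>2 * \<mu> + 1\<close>, which the
  mean value bound controls uniformly in \<open>q\<close>. From odd \<open>k\<close> it changes by
  \<open>1 - 2 * \<mu> < 0\<close>, so the bracket does not grow.\<close>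

lemma dunkl_bracket_Suc_le:
  "dunkl_bracket \<mu> q (Suc k) \<le> dunkl_bracket \<mu> q k + (2 * \<mu> + 1)"
proof (cases "even k")
  case True
  have "q powr real k * (1 - q powr (2 * \<mu> + 1)) \<le> 1 * (1 - q powr (2 * \<mu> + 1))"
    using q0 q1 mu by (intro mult_right_mono) (auto simp: powr_le1)
  also have "\<dots> \<le> (2 * \<mu> + 1) * (1 - q)"
    using one_minus_powr_le [of q "2 * \<mu> + 1"] q0 q1 mu by simp
  finally have "q powr real k - q powr (2 * \<mu> + 1 + real k) \<le> (2 * \<mu> + 1) * (1 - q)"
    by (simp add: powr_add algebra_simps)
  then have "(1 - q powr (2 * \<mu> + 1 + real k)) / (1 - q)
      \<le> (1 - q powr real k + (2 * \<mu> + 1) * (1 - q)) / (1 - q)"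
    using q1 by (intro divide_right_mono) auto
  then show ?thesis
    using True q1 by (simp add: dunkl_bracket_def theta_def add_divide_distrib add_ac)
next
  case False
  have "q powr (2 * \<mu> + real k) \<le> q powr (1 + real k)"
    using q0 q1 mu by (intro powr_mono') auto
  then have "dunkl_bracket \<mu> q (Suc k) \<le> dunkl_bracket \<mu> q k"
    using False q1 by (simp add: dunkl_bracket_def theta_def divide_right_mono)
  with mu show ?thesis
    by linarith
qed

section \<open>Weights and the Dunkl q-exponential\<close>

lemma dunkl_gamma_Suc:
  "dunkl_gamma \<mu> q (Suc k) = dunkl_bracket \<mu> q (Suc k) * dunkl_gamma \<mu> q k"
  by (simp add: dunkl_bracket_def add_ac)

lemma dunkl_gamma_pos: "0 < dunkl_gamma \<mu> q k"
proof (induction k)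
  case (Suc k)
  with dunkl_bracket_Suc_ge_1 [of k] show ?case
    unfolding dunkl_gamma_Suc by (intro mult_pos_pos) auto
qed simp

text \<open>The bracket cancels the new factor of \<open>dunkl_gamma\<close>, and the triangular
  exponent of \<open>q\<close> grows by exactly \<open>k\<close>. All moment computations rest on
  this recursion.\<close>

lemma dunkl_weight_Suc:
  "dunkl_bracket \<mu> q (Suc k) * dunkl_weight \<mu> q y (Suc k) = y * q ^ k * dunkl_weight \<mu> q y k"
proof -
  have "Suc k * k = k * (k - 1) + k * 2"
    by (cases k) auto
  then have "Suc k * k div 2 = k * (k - 1) div 2 + k"
    by simp
  then have exp: "q ^ (Suc k * (Suc k - 1) div 2) = q ^ (k * (k - 1) div 2) * q ^ k"
    by (simp only: diff_Suc_1 power_add)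
  have "dunkl_bracket \<mu> q (Suc k) \<noteq> 0" "dunkl_gamma \<mu> q k \<noteq> 0"
    using dunkl_bracket_Suc_ge_1 [of k] dunkl_gamma_pos [of k] by auto
  then show ?thesis
    unfolding dunkl_weight_def exp dunkl_gamma_Suc by (simp add: field_simps)
qed

text \<open>Lets sums of weights over \<open>q ^ k\<close> be read as the exponential at
  \<open>y / q\<close>.\<close>

lemma dunkl_weight_divide: "dunkl_weight \<mu> q (y / q) k = dunkl_weight \<mu> q y k / q ^ k"
  by (simp add: dunkl_weight_def power_divide)

lemma dunkl_weight_0: "dunkl_weight \<mu> q y 0 = 1"
  by (simp add: dunkl_weight_def)

lemma dunkl_weight_nonneg: "0 \<le> y \<Longrightarrow> 0 \<le> dunkl_weight \<mu> q y k"
  using q0 dunkl_gamma_pos [of k] by (simp add: dunkl_weight_def)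

text \<open>Since the bracket is at least 1, consecutive weights have ratio at most
  \<open>y * q ^ k\<close>, which tends to 0.\<close>

lemma summable_dunkl_weight:
  assumes y: "0 \<le> y"
  shows "summable (dunkl_weight \<mu> q y)"
proof -
  have "(\<lambda>k. y * q ^ k) \<longlonglongrightarrow> y * 0"
    using q0 q1 by (intro tendsto_mult tendsto_const LIMSEQ_realpow_zero) auto
  then have "eventually (\<lambda>k. y * q ^ k < 1 / 2) sequentially"
    by (rule order_tendstoD) auto
  then obtain N where N: "\<And>k. k \<ge> N \<Longrightarrow> y * q ^ k < 1 / 2"
    by (auto simp: eventually_sequentially)
  show ?thesis
  proof (rule summable_ratio_test [of "1 / 2" N])
    fix k assume "k \<ge> N"
    have "dunkl_weight \<mu> q y (Suc k) \<le> dunkl_bracket \<mu> q (Suc k) * dunkl_weight \<mu> q y (Suc k)"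
      using dunkl_bracket_Suc_ge_1 [of k] dunkl_weight_nonneg [OF y, of "Suc k"]
      by (simp add: mult_le_cancel_right1)
    also have "\<dots> = y * q ^ k * dunkl_weight \<mu> q y k"
      by (rule dunkl_weight_Suc)
    also have "\<dots> \<le> 1 / 2 * dunkl_weight \<mu> q y k"
      using N [OF \<open>k \<ge> N\<close>] dunkl_weight_nonneg [OF y, of k] by (intro mult_right_mono) auto
    finally show "norm (dunkl_weight \<mu> q y (Suc k)) \<le> 1 / 2 * norm (dunkl_weight \<mu> q y k)"
      using dunkl_weight_nonneg [OF y] by simp
  qed simp
qed

lemma dunkl_exp_eq_suminf: "dunkl_exp \<mu> q y = suminf (dunkl_weight \<mu> q y)"
  unfolding dunkl_exp_def dunkl_weight_def ..

lemma dunkl_weight_sums: "0 \<le> y \<Longrightarrow> dunkl_weight \<mu> q y sums dunkl_exp \<mu> q y"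
  unfolding dunkl_exp_eq_suminf by (intro summable_sums summable_dunkl_weight)

lemma dunkl_exp_pos:
  assumes "0 \<le> y"
  shows "0 < dunkl_exp \<mu> q y"
  unfolding dunkl_exp_eq_suminf
  using assms by (intro suminf_pos2 [where i = 0] summable_dunkl_weight dunkl_weight_nonneg)
    (simp_all add: dunkl_weight_0)

text \<open>The lower bound on the bracket and the weight recursion bound each term at
  \<open>y / q\<close> by the same term at \<open>y\<close> plus a multiple of the preceding one;
  then the terms are summed.\<close>

lemma dunkl_exp_divide_le:
  assumes y: "0 \<le> y"
  shows "dunkl_exp \<mu> q (y / q) \<le> (1 + (1 - q) * y / q) * dunkl_exp \<mu> q y"
proof -
  let ?w = "dunkl_weight \<mu> q y"
  have bound: "dunkl_weight \<mu> q (y / q) (Suc k) \<le> ?w (Suc k) + (1 - q) * y / q * ?w k" for k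
  proof -
    have "(1 - q ^ Suc k) * ?w (Suc k) \<le> (1 - q) * (dunkl_bracket \<mu> q (Suc k) * ?w (Suc k))"
      using mult_right_mono [OF dunkl_bracket_ge dunkl_weight_nonneg [OF y], of "Suc k" "Suc k"]
      by (simp only: mult.assoc)
    also have "\<dots> = (1 - q) * y / q * ?w k * q ^ Suc k"
      unfolding dunkl_weight_Suc using q0 by simp
    finally have "?w (Suc k) \<le> (?w (Suc k) + (1 - q) * y / q * ?w k) * q ^ Suc k"
      unfolding left_diff_distrib distrib_right by (simp only: mult_1 mult.commute diff_le_eq add_ac)
    then show ?thesis
      unfolding dunkl_weight_divide using q0 by (simp only: pos_divide_le_eq zero_less_power)
  qed
  have s: "summable ?w" "summable (dunkl_weight \<mu> q (y / q))"
    using y q0 by (auto intro: summable_dunkl_weight)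
  then have s': "summable (\<lambda>k. ?w (Suc k))" "summable (\<lambda>k. dunkl_weight \<mu> q (y / q) (Suc k))"
    by (simp_all only: summable_Suc_iff)
  have "(\<Sum>k. dunkl_weight \<mu> q (y / q) (Suc k)) \<le> (\<Sum>k. ?w (Suc k) + (1 - q) * y / q * ?w k)"
    using s s' by (intro suminf_le bound summable_add summable_mult)
  also have "\<dots> = (\<Sum>k. ?w (Suc k)) + (1 - q) * y / q * suminf ?w"
    using s s' by (simp only: suminf_add [symmetric] suminf_mult summable_mult)
  \<comment> \<open>Both series start with the term 1, so restoring the heads keeps the
    inequality.\<close>
  finally show ?thesis
    unfolding dunkl_exp_eq_suminf
    using suminf_split_head [OF s(1)] suminf_split_head [OF s(2)]
    by (simp add: dunkl_weight_0 algebra_simps)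
qed

section \<open>Nodes of the operator\<close>

context
  fixes n :: nat
  assumes n: "1 \<le> n"
begin

lemma q_bracket_pos: "0 < q_bracket q n"
  using q0 q1 n by (simp add: q_bracket_def power_less_one_iff)

lemma dunkl_node_eq:
  "dunkl_node \<mu> q n k = q\<^sup>2 * dunkl_bracket \<mu> q k / (q ^ k * q_bracket q n)"
proof -
  have "q powi (int k - 2) = q ^ k / q\<^sup>2"
    using q0 by (simp add: power_int_diff)
  then show ?thesis
    using q0 q1 by (simp add: dunkl_node_def dunkl_bracket_def q_bracket_def)
qed

lemma dunkl_node_0: "dunkl_node \<mu> q n 0 = 0"
  by (simp add: dunkl_node_eq dunkl_bracket_0)

lemma dunkl_node_nonneg: "0 \<le> dunkl_node \<mu> q n k"
  using q0 q_bracket_pos dunkl_bracket_nonneg [of k] by (simp add: dunkl_node_eq)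

text \<open>The bounded bracket increment turns into an error proportional to
  \<open>1 / q ^ k\<close>, which is why weights at a rescaled argument enter the second
  moment.\<close>

lemma dunkl_node_Suc_le:
  "dunkl_node \<mu> q n (Suc k) \<le> dunkl_node \<mu> q n k / q + (2 * \<mu> + 1) * q / q_bracket q n / q ^ k"
proof -
  have "dunkl_node \<mu> q n (Suc k) = q / (q ^ k * q_bracket q n) * dunkl_bracket \<mu> q (Suc k)"
    using q0 q_bracket_pos by (simp add: dunkl_node_eq power2_eq_square field_simps)
  also have "\<dots> \<le> q / (q ^ k * q_bracket q n) * (dunkl_bracket \<mu> q k + (2 * \<mu> + 1))"
    using q0 q_bracket_pos by (intro mult_left_mono dunkl_bracket_Suc_le) auto
  also have "\<dots> = dunkl_node \<mu> q n k / q + (2 * \<mu> + 1) * q / q_bracket q n / q ^ k"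
    using q0 q_bracket_pos by (simp add: dunkl_node_eq power2_eq_square field_simps)
  finally show ?thesis .
qed

section \<open>Moments and the pointwise error estimate\<close>

context
  fixes x :: real
  assumes x: "0 \<le> x"
begin

private abbreviation "W \<equiv> dunkl_weight \<mu> q (q_bracket q n * x)"
private abbreviation "T \<equiv> dunkl_node \<mu> q n"
private abbreviation "E \<equiv> dunkl_exp \<mu> q (q_bracket q n * x)"

private lemma arg_nonneg: "0 \<le> q_bracket q n * x"
  using q_bracket_pos x by simp

text \<open>The power \<open>q ^ Suc k\<close> in the denominator of the node absorbs the
  \<open>q ^ k\<close> of the weight recursion, and \<open>q_bracket q n\<close> cancels.\<close>

lemma dunkl_weight_node_Suc: "W (Suc k) * T (Suc k) = q * x * W k"
proof -
  have "W (Suc k) * T (Suc k) =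
      q\<^sup>2 / (q ^ Suc k * q_bracket q n) * (dunkl_bracket \<mu> q (Suc k) * W (Suc k))"
    by (simp add: dunkl_node_eq)
  also have "\<dots> = q * x * W k"
    unfolding dunkl_weight_Suc using q0 q_bracket_pos by (simp add: power2_eq_square)
  finally show ?thesis .
qed

text \<open>Node 0 is 0, so the shifted series, a multiple of the weight series, has the same
  sum.\<close>

lemma dunkl_first_moment: "(\<lambda>k. W k * T k) sums (q * x * E)"
proof -
  have "(\<lambda>k. W (Suc k) * T (Suc k)) sums (q * x * E)"
    unfolding dunkl_weight_node_Suc by (intro sums_mult dunkl_weight_sums arg_nonneg)
  then show ?thesis
    using sums_Suc_iff [of "\<lambda>k. W k * T k"] by (simp add: dunkl_node_0)
qed

text \<open>One node factor is traded for an index shift, and the other is compared with its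
  predecessor. The conclusion includes convergence, since a bound on a \<open>suminf\<close> alone
  would not give it.\<close>

lemma dunkl_second_moment:
  obtains S where "(\<lambda>k. W k * (T k)\<^sup>2) sums S"
    and "S \<le> (q * x\<^sup>2 + (2 * \<mu> + 1) * x * (1 + x) / q_bracket q n) * E"
proof -
  let ?m = "q_bracket q n"
  let ?c = "(2 * \<mu> + 1) * q / ?m"
  \<comment> \<open>The majorant is \<open>q * x * W k\<close> times the bound for
    \<open>T (Suc k)\<close>; its first part sums by the first moment, its second by the exponential
    at \<open>?m * x / q\<close>.\<close>
  let ?b = "\<lambda>k. x * (W k * T k) + q * x * ?c * dunkl_weight \<mu> q (?m * x / q) k"
  have b: "?b sums (x * (q * x * E) + q * x * ?c * dunkl_exp \<mu> q (?m * x / q))"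
    using arg_nonneg q0
    by (intro sums_add sums_mult dunkl_first_moment dunkl_weight_sums) simp
  have eq: "W (Suc k) * (T (Suc k))\<^sup>2 = q * x * W k * T (Suc k)" for k
    using dunkl_weight_node_Suc [of k] by (simp add: power2_eq_square mult.assoc [symmetric])
  have le: "W (Suc k) * (T (Suc k))\<^sup>2 \<le> ?b k" for k
  proof -
    have "q * x * W k * T (Suc k) \<le> q * x * W k * (T k / q + ?c / q ^ k)"
      using q0 x by (intro mult_left_mono dunkl_node_Suc_le)
        (simp add: dunkl_weight_nonneg arg_nonneg)
    also have "\<dots> = ?b k"
      unfolding dunkl_weight_divide using q0 q_bracket_pos by (simp add: field_simps)
    finally show ?thesis
      unfolding eq .
  qed
  have nn: "0 \<le> W k * (T k)\<^sup>2" for k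
    by (simp add: dunkl_weight_nonneg arg_nonneg)
  have s: "summable (\<lambda>k. W (Suc k) * (T (Suc k))\<^sup>2)"
    using sums_summable [OF b] by (rule summable_comparison_test')
      (simp only: real_norm_def abs_of_nonneg nn le)
  have "(\<lambda>k. W k * (T k)\<^sup>2) sums (\<Sum>k. W (Suc k) * (T (Suc k))\<^sup>2)"
    using sums_Suc_iff [of "\<lambda>k. W k * (T k)\<^sup>2"] summable_sums [OF s] by (simp add: dunkl_node_0)
  moreover have "(\<Sum>k. W (Suc k) * (T (Suc k))\<^sup>2) \<le> (q * x\<^sup>2 + (2 * \<mu> + 1) * x * (1 + x) / ?m) * E"
  proof -
    have "(\<Sum>k. W (Suc k) * (T (Suc k))\<^sup>2)
        \<le> x * (q * x * E) + q * x * ?c * dunkl_exp \<mu> q (?m * x / q)"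
      using le summable_sums [OF s] b by (rule sums_le)
    also have "\<dots> \<le> x * (q * x * E) + q * x * ?c * ((1 + (1 - q) * (?m * x) / q) * E)"
      using q0 mu x q_bracket_pos
      by (intro add_left_mono mult_left_mono dunkl_exp_divide_le arg_nonneg) auto
    \<comment> \<open>Grouped to isolate \<open>(1 - q) * ?m\<close>, which equals
      \<open>1 - q ^ n\<close> and is at most 1.\<close>
    also have "\<dots> = (q * x\<^sup>2 + (2 * \<mu> + 1) * x / ?m * (q\<^sup>2 + q * x * ((1 - q) * ?m))) * E"
      using q0 q_bracket_pos by (simp add: field_simps power2_eq_square)
    also have "\<dots> \<le> (q * x\<^sup>2 + (2 * \<mu> + 1) * x / ?m * (1 + x)) * E"
    proof (intro mult_right_mono add_left_mono mult_left_mono add_mono)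
      show "q\<^sup>2 \<le> 1"
        using q0 q1 by (simp add: power_le_one)
      have "q * ((1 - q) * ?m) \<le> 1 * 1"
        using q0 q1 by (intro mult_mono) (auto simp: q_bracket_def power_le_one)
      then have "x * (q * ((1 - q) * ?m)) \<le> x * 1"
        using x by (intro mult_left_mono) auto
      then show "q * x * ((1 - q) * ?m) \<le> x"
        by (simp add: mult_ac)
      show "0 \<le> (2 * \<mu> + 1) * x / ?m"
        using mu x q_bracket_pos by simp
      show "0 \<le> E"
        using dunkl_exp_pos [OF arg_nonneg] by simp
    qed
    finally show ?thesis
      by simp
  qed
  ultimately show thesis
    using that by blast
qed

text \<open>Expanding the square, the coefficients of \<open>x\<^sup>2\<close> combine as
  \<open>q - 2 * q + 1 = 1 - q\<close>.\<close>

lemma dunkl_second_central_moment: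
  obtains S where "(\<lambda>k. W k * (T k - x)\<^sup>2) sums S"
    and "S \<le> ((1 - q) * x\<^sup>2 + (2 * \<mu> + 1) * x * (1 + x) / q_bracket q n) * E"
proof -
  obtain S where S: "(\<lambda>k. W k * (T k)\<^sup>2) sums S"
      "S \<le> (q * x\<^sup>2 + (2 * \<mu> + 1) * x * (1 + x) / q_bracket q n) * E"
    by (rule dunkl_second_moment)
  have "(\<lambda>k. W k * (T k)\<^sup>2 - 2 * x * (W k * T k) + x\<^sup>2 * W k)
      sums (S - 2 * x * (q * x * E) + x\<^sup>2 * E)"
    by (intro sums_add sums_diff sums_mult S dunkl_first_moment dunkl_weight_sums arg_nonneg)
  moreover have "W k * (T k)\<^sup>2 - 2 * x * (W k * T k) + x\<^sup>2 * W k = W k * (T k - x)\<^sup>2" for k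
    by (simp add: power2_eq_square algebra_simps)
  ultimately show thesis
    using S(2) by (intro that) (auto simp: algebra_simps power2_eq_square)
qed

text \<open>The weights are nonnegative with total mass \<open>E\<close>, so the pointwise bound can
  be averaged against them.\<close>

lemma dunkl_szasz_approx:
  assumes C: "0 \<le> C" and f: "\<And>t. 0 \<le> t \<Longrightarrow> \<bar>f t - f x\<bar> \<le> e + C * (t - x)\<^sup>2"
  shows "\<bar>dunkl_szasz \<mu> q n f x - f x\<bar>
    \<le> e + C * ((1 - q) * x\<^sup>2 + (2 * \<mu> + 1) * x * (1 + x) / q_bracket q n)"
proof -
  obtain S where S: "(\<lambda>k. W k * (T k - x)\<^sup>2) sums S"
      "S \<le> ((1 - q) * x\<^sup>2 + (2 * \<mu> + 1) * x * (1 + x) / q_bracket q n) * E"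
    by (rule dunkl_second_central_moment)
  have E: "0 < E"
    by (intro dunkl_exp_pos arg_nonneg)
  have bnd: "norm (W k * (f (T k) - f x)) \<le> e * W k + C * (W k * (T k - x)\<^sup>2)" for k
    using mult_left_mono [OF f [OF dunkl_node_nonneg [of k]] dunkl_weight_nonneg [OF arg_nonneg, of k]]
    using dunkl_weight_nonneg [OF arg_nonneg, of k]
    by (simp only: real_norm_def abs_mult abs_of_nonneg distrib_left mult_ac)
  have bsum: "(\<lambda>k. e * W k + C * (W k * (T k - x)\<^sup>2)) sums (e * E + C * S)"
    by (intro sums_add sums_mult S dunkl_weight_sums arg_nonneg)
  \<comment> \<open>Domination gives absolute convergence; without it the \<open>suminf\<close> in
    the operator would carry no information.\<close>
  have sm: "summable (\<lambda>k. norm (W k * (f (T k) - f x)))"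
    using sums_summable [OF bsum] by (rule summable_comparison_test') (use bnd in simp)
  define R where "R = (\<Sum>k. W k * (f (T k) - f x))"
  have R: "(\<lambda>k. W k * (f (T k) - f x)) sums R"
    unfolding R_def by (intro summable_sums summable_norm_cancel [OF sm])
  have "\<bar>R\<bar> \<le> (\<Sum>k. norm (W k * (f (T k) - f x)))"
    unfolding R_def using summable_norm [OF sm] by simp
  also have "\<dots> \<le> e * E + C * S"
    using bnd summable_sums [OF sm] bsum by (rule sums_le)
  also have "\<dots> \<le> (e + C * ((1 - q) * x\<^sup>2 + (2 * \<mu> + 1) * x * (1 + x) / q_bracket q n)) * E"
    using mult_left_mono [OF S(2) C] by (simp add: algebra_simps)
  finally have "\<bar>R\<bar> / E \<le> e + C * ((1 - q) * x\<^sup>2 + (2 * \<mu> + 1) * x * (1 + x) / q_bracket q n)"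
    using E by (simp add: pos_divide_le_eq)
  moreover have "dunkl_szasz \<mu> q n f x - f x = R / E"
  proof -
    have "(\<lambda>k. W k * (f (T k) - f x) + f x * W k) sums (R + f x * E)"
      by (intro sums_add sums_mult R dunkl_weight_sums arg_nonneg)
    then have "(\<lambda>k. W k * f (T k)) sums (R + f x * E)"
      by (simp add: algebra_simps)
    then have "(\<Sum>k. W k * f (T k)) = R + f x * E"
      by (rule sums_unique [symmetric])
    then have "dunkl_szasz \<mu> q n f x = 1 / E * (R + f x * E)"
      by (simp add: dunkl_szasz_def dunkl_weight_def mult_ac)
    then show ?thesis
      using E by (simp add: field_simps)
  qed
  ultimately show ?thesis
    using E by simp
qed

end

end

end

section \<open>Functions of at most quadratic growth\<close>

text \<open>The limit at infinity controls the quotient beyond some \<open>b\<close>, and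
  compactness controls \<open>f\<close> on \<open>{0..b}\<close>.\<close>

lemma quadratic_growth:
  assumes "f \<in> C_half_line \<inter> H_half_line"
  obtains M where "0 \<le> M" "\<And>t. 0 \<le> t \<Longrightarrow> \<bar>f t\<bar> \<le> M * (1 + t\<^sup>2)"
proof -
  obtain L where L: "((\<lambda>t. f t / (1 + t\<^sup>2)) \<longlongrightarrow> L) at_top"
    using assms by (auto simp: H_half_line_def)
  have "eventually (\<lambda>t. \<bar>f t / (1 + t\<^sup>2)\<bar> < \<bar>L\<bar> + 1) at_top"
    using tendsto_rabs [OF L] by (rule order_tendstoD) simp
  then obtain b where b: "\<And>t. t \<ge> b \<Longrightarrow> \<bar>f t / (1 + t\<^sup>2)\<bar> < \<bar>L\<bar> + 1"
    by (auto simp: eventually_at_top_linorder)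
  have "continuous_on {0..b} f"
    using assms by (auto simp: C_half_line_def intro: continuous_on_subset)
  then have "bounded (f ` {0..b})"
    by (intro compact_imp_bounded compact_continuous_image) auto
  then obtain B where B: "\<And>t. t \<in> {0..b} \<Longrightarrow> \<bar>f t\<bar> \<le> B"
    unfolding bounded_iff by (metis imageI real_norm_def)
  \<comment> \<open>The maximum is positive even if \<open>{0..b}\<close> is empty and
    \<open>B\<close> is negative.\<close>
  let ?M = "max (\<bar>L\<bar> + 1) B"
  show thesis
  proof (rule that [of ?M])
    fix t :: real
    assume "0 \<le> t"
    have pos: "0 < 1 + t\<^sup>2"
      by (simp add: add_pos_nonneg)
    show "\<bar>f t\<bar> \<le> ?M * (1 + t\<^sup>2)"
    proof (cases "t \<le> b")
      case True
      then have "\<bar>f t\<bar> \<le> ?M * 1"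
        using B [of t] \<open>0 \<le> t\<close> by simp
      also have "\<dots> \<le> ?M * (1 + t\<^sup>2)"
        by (intro mult_left_mono) auto
      finally show ?thesis .
    next
      case False
      then have "\<bar>f t\<bar> \<le> (\<bar>L\<bar> + 1) * (1 + t\<^sup>2)"
        using b [of t] pos by (simp add: field_simps)
      also have "\<dots> \<le> ?M * (1 + t\<^sup>2)"
        using pos by (intro mult_right_mono) auto
      finally show ?thesis .
    qed
  qed simp
qed

text \<open>Near \<open>x\<close>, uniform continuity gives \<open>e\<close>. At distance at least
  \<open>d\<close>, the factor \<open>(t - x)\<^sup>2 / d\<^sup>2\<close> is at least 1, so the
  constant part of the growth bound is absorbed.\<close>

lemma quadratic_modulus:
  assumes f: "f \<in> C_half_line \<inter> H_half_line" and e: "0 < e" and R: "0 \<le> R"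
  obtains C where "0 \<le> C"
    and "\<And>x t. \<lbrakk>0 \<le> x; x \<le> R; 0 \<le> t\<rbrakk> \<Longrightarrow> \<bar>f t - f x\<bar> \<le> e + C * (t - x)\<^sup>2"
proof -
  obtain M where M: "0 \<le> M" "\<And>t. 0 \<le> t \<Longrightarrow> \<bar>f t\<bar> \<le> M * (1 + t\<^sup>2)"
    by (rule quadratic_growth [OF f]) blast
  \<comment> \<open>The margin 1, with \<open>d\<close> capped at 1 below, keeps every
    \<open>t\<close> close to \<open>x\<close> inside the interval.\<close>
  have "continuous_on {0..R + 1} f"
    using f by (auto simp: C_half_line_def intro: continuous_on_subset)
  then have "uniformly_continuous_on {0..R + 1} f"
    by (intro compact_uniformly_continuous) auto
  then obtain d0 where d0: "d0 > 0"
      "\<And>s t. \<lbrakk>s \<in> {0..R + 1}; t \<in> {0..R + 1}; dist t s < d0\<rbrakk> \<Longrightarrow> dist (f t) (f s) < e"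
    using e unfolding uniformly_continuous_on_def by metis
  define d where "d = min d0 1"
  have d: "0 < d"
    using d0 by (simp add: d_def)
  \<comment> \<open>This comes from \<open>t\<^sup>2 + x\<^sup>2 \<le> 2 * (t - x)\<^sup>2 + 3 *
    R\<^sup>2\<close>, plus 1 from each of the two growth bounds.\<close>
  let ?A = "2 + 3 * R\<^sup>2"
  let ?C = "M * (?A / d\<^sup>2 + 2)"
  show thesis
  proof (rule that [of ?C])
    show C: "0 \<le> ?C"
      using M(1) by simp
    fix x t :: real
    assume x: "0 \<le> x" "x \<le> R" and t: "0 \<le> t"
    show "\<bar>f t - f x\<bar> \<le> e + ?C * (t - x)\<^sup>2"
    proof (cases "\<bar>t - x\<bar> < d")
      case True
      then have "\<bar>f t - f x\<bar> < e"
        using d0(2) [of x t] x t by (auto simp: d_def dist_real_def)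
      moreover have "0 \<le> ?C * (t - x)\<^sup>2"
        using C by (rule mult_nonneg_nonneg) simp
      ultimately show ?thesis
        by linarith
    next
      case False
      then have "d\<^sup>2 \<le> (t - x)\<^sup>2"
        using d by (simp add: abs_le_square_iff [symmetric])
      then have far: "1 \<le> (t - x)\<^sup>2 / d\<^sup>2"
        using d by simp
      have "2 * (t - x)\<^sup>2 + 2 * x\<^sup>2 - t\<^sup>2 = (t - 2 * x)\<^sup>2"
        by (simp add: power2_eq_square algebra_simps)
      then have t2: "t\<^sup>2 \<le> 2 * (t - x)\<^sup>2 + 2 * x\<^sup>2"
        by (smt (verit) zero_le_power2)
      have x2: "x\<^sup>2 \<le> R\<^sup>2"
        using x by (intro power_mono) auto
      have "\<bar>f t - f x\<bar> \<le> M * (1 + t\<^sup>2) + M * (1 + x\<^sup>2)"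
        using M(2) [of t] M(2) [of x] x t by linarith
      also have "\<dots> = M * (2 + t\<^sup>2 + x\<^sup>2)"
        by (simp add: algebra_simps)
      also have "\<dots> \<le> M * (?A * 1 + 2 * (t - x)\<^sup>2)"
        using t2 x2 by (intro mult_left_mono M(1)) simp
      also have "\<dots> \<le> M * (?A * ((t - x)\<^sup>2 / d\<^sup>2) + 2 * (t - x)\<^sup>2)"
        by (intro mult_left_mono add_right_mono far M(1)) simp
      also have "\<dots> = ?C * (t - x)\<^sup>2"
        by (simp add: algebra_simps)
      finally show ?thesis
        using e by linarith
    qed
  qed
qed

section \<open>Passage to the limit\<close>

text \<open>The bracket is the geometric sum of \<open>q n ^ j\<close> over \<open>j < n\<close>.
  Its first \<open>N\<close> terms alone tend to \<open>N\<close>, and \<open>N\<close> is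
  arbitrary.\<close>

lemma q_bracket_at_top:
  fixes q :: "nat \<Rightarrow> real"
  assumes q01: "\<And>n. n \<ge> 1 \<Longrightarrow> 0 < q n \<and> q n < 1" and q: "q \<longlonglongrightarrow> 1"
  shows "filterlim (\<lambda>n. q_bracket (q n) n) at_top sequentially"
proof (rule filterlim_at_top_gt [where c = 0, THEN iffD2], intro allI impI)
  fix Z :: real
  obtain N where N: "Z < real N"
    using reals_Archimedean2 by blast
  have "(\<lambda>n. \<Sum>j<N. q n ^ j) \<longlonglongrightarrow> (\<Sum>j<N. 1 ^ j)"
    by (intro tendsto_intros q)
  then have "eventually (\<lambda>n. Z < (\<Sum>j<N. q n ^ j)) sequentially"
    using N by (intro order_tendstoD) auto
  then show "eventually (\<lambda>n. Z \<le> q_bracket (q n) n) sequentially"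
    using eventually_ge_at_top [of "max 1 N"]
  proof eventually_elim
    case (elim n)
    then have qn: "0 < q n" "q n < 1"
      using q01 [of n] by auto
    have "(\<Sum>j<N. q n ^ j) \<le> (\<Sum>j<n. q n ^ j)"
      using elim qn by (intro sum_mono2) auto
    also have "\<dots> = q_bracket (q n) n"
      using qn by (simp add: q_bracket_def sum_gp_strict)
    finally show ?case
      using elim by linarith
  qed
qed

theorem theorem2p3:
  fixes \<mu> a :: real and q :: "nat \<Rightarrow> real" and f :: "real \<Rightarrow> real"
  assumes "\<mu> > 1 / 2"
    and "\<And>n. n \<ge> 1 \<Longrightarrow> 0 < q n \<and> q n < 1"
    and "q \<longlonglongrightarrow> 1"
    and "(\<lambda>n. q n ^ n) \<longlonglongrightarrow> a"
    and "f \<in> C_half_line \<inter> H_half_line"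
  shows "\<forall>K. compact K \<and> K \<subseteq> {0..} \<longrightarrow>
           uniform_limit K (\<lambda>n x. dunkl_szasz \<mu> (q n) n f x) f sequentially"
proof (intro allI impI uniform_limitI)
  fix K :: "real set" and e :: real
  assume K: "compact K \<and> K \<subseteq> {0..}" and e: "0 < e"
  obtain R where R: "0 \<le> R" "\<And>x. x \<in> K \<Longrightarrow> x \<le> R"
    using compact_imp_bounded [of K] K unfolding bounded_pos
    by (metis abs_le_D1 less_imp_le real_norm_def)
  obtain C where C: "0 \<le> C"
      "\<And>x t. \<lbrakk>0 \<le> x; x \<le> R; 0 \<le> t\<rbrakk> \<Longrightarrow> \<bar>f t - f x\<bar> \<le> e / 2 + C * (t - x)\<^sup>2"
    using quadratic_modulus [OF assms(5), of "e / 2" R] e R(1) by auto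
  \<comment> \<open>The error bound is increasing in \<open>x\<close> on \<open>{0..R}\<close>, so
    its value at \<open>R\<close> serves all of \<open>K\<close>.\<close>
  define b where
    "b n = C * ((1 - q n) * R\<^sup>2 + (2 * \<mu> + 1) * R * (1 + R) / q_bracket (q n) n)" for n
  have "b \<longlonglongrightarrow> C * ((1 - 1) * R\<^sup>2 + 0)"
    unfolding b_def
    by (intro tendsto_intros assms(3) tendsto_divide_0 [OF tendsto_const]
        filterlim_at_top_imp_at_infinity q_bracket_at_top assms(2))
  then have "eventually (\<lambda>n. b n < e / 2) sequentially"
    using e by (intro order_tendstoD) auto
  then show "eventually (\<lambda>n. \<forall>x\<in>K. dist (dunkl_szasz \<mu> (q n) n f x) (f x) < e) sequentially"
    using eventually_ge_at_top [of 1]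
  proof eventually_elim
    case (elim n)
    have qn: "0 < q n" "q n < 1"
      using assms(2) elim by auto
    have m: "0 < q_bracket (q n) n"
      using q_bracket_pos [OF assms(1) qn] elim by simp
    show ?case
    proof
      fix x
      assume "x \<in> K"
      then have x: "0 \<le> x" "x \<le> R"
        using K R by auto
      have "\<bar>dunkl_szasz \<mu> (q n) n f x - f x\<bar>
          \<le> e / 2 + C * ((1 - q n) * x\<^sup>2 + (2 * \<mu> + 1) * x * (1 + x) / q_bracket (q n) n)"
        using assms(1) qn elim(2) x(1) C(1) C(2) [OF x] by (rule dunkl_szasz_approx)
      also have "\<dots> \<le> e / 2 + b n"
        unfolding b_def using x m qn assms(1) C(1)
        by (intro add_mono mult_left_mono divide_right_mono mult_mono power_mono) auto
      also have "\<dots> < e"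
        using elim by simp
      finally show "dist (dunkl_szasz \<mu> (q n) n f x) (f x) < e"
        by (simp add: dist_real_def)
    qed
  qed
qed

end
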